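(* For every integer $m\ge 1$, the function $x\mapsto \varphi_m(x)$, $x\ge 0$, defined by $$\varphi_{m}(x)=\frac{2}{(G_{+}(x))^{m}+(G_{-}(x))^{m}},\qquad G_{\pm}(x)=\sqrt{1+x}\pm\sqrt{x},$$ is the Laplace transform of an infinitely divisible random variable $K$, i.e. $\varphi_m(x)=E[e^{-xK}]$ for all $x\ge 0$. More specifically, $K$ admits (in law) the following decompositions: \begin{itemize} \item if $m=2n+1$ (with $n\ge 0$ an integer), $$K=\frac{\mathcal{N}^{2}}{2}+\sum_{k=1}^{n} a_{k}\,\mathbf{e}_{k},\qquad a_{k}=\frac{1}{\sin^{2}\left(\frac{\pi}{2}\,\frac{2k-1}{2n+1}\right)},\quad k=1,2,\ldots,n;$$ \item if $m=2n$ (with $n\ge 1$ an integer), $$K=\sum_{k=1}^{n} b_{k}\,\mathbf{e}_{k},\qquad b_{k}=\frac{1}{\sin^{2}\left(\frac{\pi}{2}\,\frac{2k-1}{2n}\right)},\quad k=1,2,\ldots,n;$$ \end{itemize} where $\mathcal{N}$ is a centered Gaussian variable with variance $1$, and $\mathbf{e}_{1},\ldots,\mathbf{e}_{n}$ are $n$ independent exponential variables with expectation $1$, independent of $\mathcal{N}$.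
   Context: The Laplace transform of a nonnegative random variable $K$ is the function $x\mapsto E[e^{-xK}]$, $x\ge 0$. A real-valued random variable $\zeta$ is infinitely divisible if for every $n\ge 1$ there exist i.i.d. random variables $\zeta_1,\ldots,\zeta_n$ such that $\zeta$ has the same law as $\zeta_1+\cdots+\zeta_n$. Empty sums are zero. *)

theory Defs
  imports "HOL-Probability.Probability"
begin

definition G_plus :: "real \<Rightarrow> real" where
  "G_plus x = sqrt (1 + x) + sqrt x"

definition G_minus :: "real \<Rightarrow> real" where
  "G_minus x = sqrt (1 + x) - sqrt x"

definition phi :: "nat \<Rightarrow> real \<Rightarrow> real" where
  "phi m x = 2 / (G_plus x ^ m + G_minus x ^ m)"

definition laplace_transform :: "'a measure \<Rightarrow> ('a \<Rightarrow> real) \<Rightarrow> real \<Rightarrow> real" where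
  "laplace_transform M K x = prob_space.expectation M (\<lambda>\<omega>. exp (- (x * K \<omega>)))"

definition same_law :: "'a measure \<Rightarrow> ('a \<Rightarrow> real) \<Rightarrow> 'b measure \<Rightarrow> ('b \<Rightarrow> real) \<Rightarrow> bool" where
  "same_law M X M' Y \<longleftrightarrow> distr M borel X = distr M' borel Y"

text \<open>The i.i.d. summands may live on another probability space. HOL cannot quantify over the
  type of its sample space; nothing is lost by taking sequences of reals, since every finite family
  of real random variables has the joint law of coordinate functions on that space.\<close>

definition infinitely_divisible :: "'a measure \<Rightarrow> ('a \<Rightarrow> real) \<Rightarrow> bool" where
  "infinitely_divisible M \<zeta> \<longleftrightarrow>
     (\<forall>n\<ge>1. \<exists>(M' :: (nat \<Rightarrow> real) measure) (Z :: nat \<Rightarrow> (nat \<Rightarrow> real) \<Rightarrow> real).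
        prob_space M' \<and>
        prob_space.indep_vars M' (\<lambda>_. borel) Z {1..n} \<and>
        (\<forall>i\<in>{1..n}. \<forall>j\<in>{1..n}. same_law M' (Z i) M' (Z j)) \<and>
        same_law M \<zeta> M' (\<lambda>\<omega>. \<Sum>i=1..n. Z i \<omega>))"

definition exponentials :: "nat \<Rightarrow> 'a measure \<Rightarrow> (nat \<Rightarrow> 'a \<Rightarrow> real) \<Rightarrow> bool" where
  "exponentials n M e \<longleftrightarrow>
     prob_space M \<and>
     (\<forall>k\<in>{1..n}. distributed M lborel (e k) (exponential_density 1)) \<and>
     prob_space.indep_vars M (\<lambda>_. borel) e {1..n}"

text \<open>The slot \<open>0\<close>, unused by the exponential variables, carries the Gaussian one: the condition is the
  mutual independence of \<open>N, e 1, \<dots>, e n\<close>.\<close>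

definition gaussian_and_exponentials ::
    "nat \<Rightarrow> 'a measure \<Rightarrow> ('a \<Rightarrow> real) \<Rightarrow> (nat \<Rightarrow> 'a \<Rightarrow> real) \<Rightarrow> bool" where
  "gaussian_and_exponentials n M N e \<longleftrightarrow>
     exponentials n M e \<and>
     distributed M lborel N (normal_density 0 1) \<and>
     prob_space.indep_vars M (\<lambda>_. borel) (e(0 := N)) {0..n}"

definition a_coeff :: "nat \<Rightarrow> nat \<Rightarrow> real" where
  "a_coeff n k = 1 / (sin (pi / 2 * ((2 * real k - 1) / (2 * real n + 1))))\<^sup>2"

definition b_coeff :: "nat \<Rightarrow> nat \<Rightarrow> real" where
  "b_coeff n k = 1 / (sin (pi / 2 * ((2 * real k - 1) / (2 * real n))))\<^sup>2"

definition odd_sum :: "nat \<Rightarrow> ('a \<Rightarrow> real) \<Rightarrow> (nat \<Rightarrow> 'a \<Rightarrow> real) \<Rightarrow> 'a \<Rightarrow> real" where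
  "odd_sum n N e \<omega> = (N \<omega>)\<^sup>2 / 2 + (\<Sum>k=1..n. a_coeff n k * e k \<omega>)"

definition even_sum :: "nat \<Rightarrow> (nat \<Rightarrow> 'a \<Rightarrow> real) \<Rightarrow> 'a \<Rightarrow> real" where
  "even_sum n e \<omega> = (\<Sum>k=1..n. b_coeff n k * e k \<omega>)"

end

theory Submission
  imports Defs
begin

text \<open>Put \<open>x = sinh\<^sup>2 \<theta>\<close>. Then \<open>G_plus x = exp \<theta>\<close> and \<open>G_minus x = exp (- \<theta>)\<close>, so \<open>phi m x = 1 / cosh (m \<theta>)\<close>.
  Now \<open>cosh (2 n \<theta>)\<close> and \<open>cosh ((2 n + 1) \<theta>) / cosh \<theta>\<close> are polynomials in \<open>sinh\<^sup>2 \<theta>\<close> of degree \<open>n\<close>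
  with value 1 at 0, and replacing \<open>\<theta>\<close> by \<open>\<i> \<phi>\<close> turns them into \<open>cos (2 n \<phi>)\<close> and \<open>cos ((2 n + 1) \<phi>) / cos \<phi>\<close>,
  whose zeros are explicit. So \<open>phi m\<close> factors into terms \<open>(1 + c x) powr (- a)\<close>, which are the Laplace
  transforms of scaled Gamma variables: \<open>e k\<close> has the Gamma law of shape 1, and \<open>N\<^sup>2 / 2\<close> that of shape 1/2.
  Gamma laws are infinitely divisible because shapes add under convolution, and infinite divisibility is
  preserved by scaling and independent sums. Laws of sums are identified by their characteristic
  functions.\<close>

subsection \<open>Product formulas for hyperbolic cosines\<close>

text \<open>The first-order coefficient \<open>c\<close> is 2 for even and 4 for odd multiples of the angle.\<close>

fun cheb_poly :: "real \<Rightarrow> nat \<Rightarrow> real poly" where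
  "cheb_poly c 0 = 1"
| "cheb_poly c (Suc 0) = [:1, c:]"
| "cheb_poly c (Suc (Suc n)) = [:2, 4:] * cheb_poly c (Suc n) - cheb_poly c n"

text \<open>An upper bound suffices: with the value 1 at 0 and n distinct nonzero roots it
  determines the polynomial.\<close>

lemma degree_cheb: "degree (cheb_poly c n) \<le> n"
proof (induction c n rule: cheb_poly.induct)
  case (3 c n)
  have "degree ([:2, 4:] * cheb_poly c (Suc n)) \<le> Suc (Suc n)"
    using degree_mult_le[of "[:2, 4:]" "cheb_poly c (Suc n)"] 3 by simp
  then show ?case
    unfolding cheb_poly.simps using 3 by (intro degree_diff_le) auto
qed auto

lemma poly_cheb_0: "poly (cheb_poly c n) 0 = 1"
  by (induction c n rule: cheb_poly.induct) auto

lemma cosh_add_cosh_diff: "cosh (x + y) + cosh (x - y) = 2 * cosh x * cosh (y :: real)"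
  by (simp add: cosh_add cosh_diff)

lemma cos_add_cos_diff: "cos (x + y) + cos (x - y) = 2 * cos x * cos (y :: real)"
  by (simp add: cos_add cos_diff)

lemma cosh_double_sinh: "cosh (2 * x) = 1 + 2 * (sinh x)\<^sup>2" for x :: real
  by (simp add: cosh_double cosh_square_eq)

text \<open>The sum formula with u = 2 (n + 1) x gives cosh (u + 2 x) = 2 cosh (2 x) cosh u - cosh
  (u - 2 x), and 2 cosh (2 x) = 2 + 4 sinh^2 x is the multiplier \<open>[:2, 4:]\<close> of the
  recursion.\<close>

lemma cosh_conv_cheb_even: "cosh (real (2 * n) * x) = poly (cheb_poly 2 n) ((sinh x)\<^sup>2)"
proof (induction "2 :: real" n rule: cheb_poly.induct)
  case (3 n)
  show ?case
    using cosh_add_cosh_diff[of "real (2 * Suc n) * x" "2 * x"] 3 cosh_double_sinh[of x]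
    by (simp add: algebra_simps)
qed (simp_all add: cosh_double_sinh)

lemma cosh_conv_cheb_odd: "cosh (real (2 * n + 1) * x) = cosh x * poly (cheb_poly 4 n) ((sinh x)\<^sup>2)"
proof (induction "4 :: real" n rule: cheb_poly.induct)
  \<comment> \<open>The odd family has the same recursion; only this initial value differs: cosh (3
    x) = cosh x (2 cosh (2 x) - 1) = cosh x (1 + 4 sinh^2 x).\<close>
  case 2
  show ?case
    using cosh_add_cosh_diff[of "2 * x" x] cosh_double_sinh[of x] by (simp add: algebra_simps)
next
  case (3 n)
  show ?case
    using cosh_add_cosh_diff[of "real (2 * Suc n + 1) * x" "2 * x"] 3 cosh_double_sinh[of x]
    by (simp add: algebra_simps)
qed simp

text \<open>At - sin^2 x the multiplier \<open>[:2, 4:]\<close> takes the value 2 - 4 sin^2 x = 2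
  cos (2 x), so the recursion becomes the one satisfied by cosines. This is the passage to imaginary
  angles, carried out over the reals.\<close>

lemma poly_cheb_Suc_Suc_sin:
  "poly (cheb_poly c (Suc (Suc n))) (- (sin x)\<^sup>2) =
     2 * cos (2 * x) * poly (cheb_poly c (Suc n)) (- (sin x)\<^sup>2) - poly (cheb_poly c n) (- (sin x)\<^sup>2)"
  by (subst cos_double_sin) (simp add: algebra_simps)

lemma cos_conv_cheb_even: "cos (real (2 * n) * x) = poly (cheb_poly 2 n) (- (sin x)\<^sup>2)"
proof (induction "2 :: real" n rule: cheb_poly.induct)
  case (3 n)
  show ?case
    unfolding poly_cheb_Suc_Suc_sin
    using cos_add_cos_diff[of "real (2 * Suc n) * x" "2 * x"] 3
    by (simp add: algebra_simps)
qed (simp_all add: cos_double_sin)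

lemma cos_conv_cheb_odd: "cos (real (2 * n + 1) * x) = cos x * poly (cheb_poly 4 n) (- (sin x)\<^sup>2)"
proof (induction "4 :: real" n rule: cheb_poly.induct)
  case 2
  have "poly (cheb_poly 4 (Suc 0)) (- (sin x)\<^sup>2) = 2 * cos (2 * x) - 1"
    by (simp add: cos_double_sin)
  note * = this
  show ?case
    unfolding * using cos_add_cos_diff[of "2 * x" x] by (simp add: algebra_simps)
next
  case (3 n)
  show ?case
    unfolding poly_cheb_Suc_Suc_sin
    using cos_add_cos_diff[of "real (2 * Suc n + 1) * x" "2 * x"] 3
    by (simp add: algebra_simps)
qed simp

text \<open>Both sides have degree at most \<open>card A\<close> and agree at
  \<open>card A + 1\<close> points: they equal 1 at 0 and vanish at each \<open>- r k\<close>.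
  Injectivity of \<open>r\<close> keeps the roots distinct, and \<open>r k \<noteq> 0\<close> keeps
  them away from 0.\<close>

lemma poly_eq_prod_roots:
  fixes p :: "'a :: field poly"
  assumes deg: "degree p \<le> card A" and A: "finite A" "inj_on r A"
    and p0: "poly p 0 = 1" and roots: "\<And>k. k \<in> A \<Longrightarrow> r k \<noteq> 0 \<and> poly p (- r k) = 0"
  shows "poly p y = (\<Prod>k\<in>A. 1 + y / r k)"
proof -
  define q where "q = (\<Prod>k\<in>A. [:1, 1 / r k:])"
  have "degree q \<le> (\<Sum>k\<in>A. 1)"
    unfolding q_def
    by (rule order.trans[OF degree_prod_sum_le[OF A(1)]], rule sum_mono) auto
  then have degq: "degree q \<le> card A" by simp
  define B where "B = insert 0 ((\<lambda>k. - r k) ` A)"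
  have "card B = Suc (card A)"
    unfolding B_def using A roots
    by (subst card_insert_disjoint) (auto simp: card_image inj_on_def)
  moreover have "poly p x = poly q x" if "x \<in> B" for x
    using that A roots p0 unfolding B_def q_def
    by (auto simp: poly_prod prod_zero_iff intro!: bexI)
  ultimately have "p = q"
    using deg degq by (intro poly_eqI_degree[of B]) auto
  then show ?thesis by (simp add: q_def poly_prod divide_inverse)
qed

lemma sin_square_inj_on: "inj_on (\<lambda>x. (sin x)\<^sup>2) {0<..<pi / 2}"
proof (rule inj_onI)
  fix x y :: real assume "x \<in> {0<..<pi / 2}" "y \<in> {0<..<pi / 2}" "(sin x)\<^sup>2 = (sin y)\<^sup>2"
  moreover from this have "sin x > 0" "sin y > 0" by (auto intro!: sin_gt_zero)
  ultimately show "x = y"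
    using sin_inj_pi[of x y] by (auto simp: power2_eq_iff)
qed

text \<open>The form used for both parities: distinct angles strictly between 0 and pi / 2 have
  distinct nonzero squared sines.\<close>

lemma poly_eq_prod_sin_squares:
  fixes p :: "real poly"
  assumes deg: "degree p \<le> card A" and A: "finite A" "inj_on \<phi> A" "\<phi> ` A \<subseteq> {0<..<pi / 2}"
    and p0: "poly p 0 = 1" and roots: "\<And>k. k \<in> A \<Longrightarrow> poly p (- (sin (\<phi> k))\<^sup>2) = 0"
  shows "poly p y = (\<Prod>k\<in>A. 1 + 1 / (sin (\<phi> k))\<^sup>2 * y)"
proof -
  have "inj_on (\<lambda>k. (sin (\<phi> k))\<^sup>2) A"
    using comp_inj_on[OF A(2) inj_on_subset[OF sin_square_inj_on A(3)]] by (simp add: comp_def)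
  moreover have "sin (\<phi> k) \<noteq> 0" if "k \<in> A" for k
    using A(3) that sin_gt_zero[of "\<phi> k"] by (force simp: image_subset_iff)
  ultimately show ?thesis
    using poly_eq_prod_roots[OF deg A(1), of "\<lambda>k. (sin (\<phi> k))\<^sup>2" y] p0 roots by simp
qed

text \<open>The source of all roots. As k \<ge> 1, the natural number \<open>2 * k - 1\<close>
  offered as odd multiple of pi / 2 is not truncated.\<close>

lemma cos_odd_half_pi: "k \<ge> 1 \<Longrightarrow> cos (pi / 2 * (2 * real k - 1)) = 0"
  by (simp add: cos_zero_iff) (rule disjI1, rule exI[of _ "2 * k - 1"], simp add: of_nat_diff)

lemma half_pi_mult_mem: "0 < t \<Longrightarrow> t < 1 \<Longrightarrow> pi / 2 * t \<in> {0<..<pi / 2}"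
  using mult_strict_left_mono[of t 1 "pi / 2"] by simp

lemma cosh_even_prod:
  assumes "n \<ge> 1"
  shows "cosh (real (2 * n) * x) = (\<Prod>k=1..n. 1 + b_coeff n k * (sinh x)\<^sup>2)"
  unfolding cosh_conv_cheb_even b_coeff_def
proof (rule poly_eq_prod_sin_squares)
  \<comment> \<open>Chosen so that 2 n times the angle is the odd multiple (2 k - 1) pi / 2, a zero
    of the cosine.\<close>
  let ?\<phi> = "\<lambda>k. pi / 2 * ((2 * real k - 1) / (2 * real n))"
  show "inj_on ?\<phi> {1..n}"
    using assms by (auto simp: inj_on_def field_simps)
  show "?\<phi> ` {1..n} \<subseteq> {0<..<pi / 2}"
    by (intro image_subsetI half_pi_mult_mem) (auto simp: field_simps)
  show "poly (cheb_poly 2 n) (- (sin (?\<phi> k))\<^sup>2) = 0" if "k \<in> {1..n}" for k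
    using cos_odd_half_pi[of k] that assms by (simp flip: cos_conv_cheb_even)
qed (use degree_cheb poly_cheb_0 in auto)

lemma cosh_odd_prod:
  "cosh (real (2 * n + 1) * x) = cosh x * (\<Prod>k=1..n. 1 + a_coeff n k * (sinh x)\<^sup>2)"
  unfolding cosh_conv_cheb_odd a_coeff_def
proof (rule arg_cong[where f = "(*) _"], rule poly_eq_prod_sin_squares)
  let ?\<phi> = "\<lambda>k. pi / 2 * ((2 * real k - 1) / (2 * real n + 1))"
  show "inj_on ?\<phi> {1..n}"
    by (auto simp: inj_on_def field_simps)
  show *: "?\<phi> ` {1..n} \<subseteq> {0<..<pi / 2}"
    by (intro image_subsetI half_pi_mult_mem) (auto simp: field_simps)
  show "poly (cheb_poly 4 n) (- (sin (?\<phi> k))\<^sup>2) = 0" if "k \<in> {1..n}" for k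
  proof -
    have "real (2 * n + 1) * ?\<phi> k = pi / 2 * (2 * real k - 1)"
      by (simp add: field_simps)
    \<comment> \<open>The zero of cos ((2 n + 1) x) yields only a vanishing product; its first
      factor is nonzero because the angle lies strictly between 0 and pi / 2.\<close>
    then have "cos (?\<phi> k) * poly (cheb_poly 4 n) (- (sin (?\<phi> k))\<^sup>2) = 0"
      using cos_odd_half_pi[of k] that by (simp only: flip: cos_conv_cheb_odd) simp
    moreover have "?\<phi> k \<in> {0<..<pi / 2}"
      using * that by blast
    then have "cos (?\<phi> k) \<noteq> 0"
      using cos_gt_zero[of "?\<phi> k"] by (metis greaterThanLessThan_iff less_irrefl)
    ultimately show ?thesis
      by (metis mult_eq_0_iff)
  qed
qed (use degree_cheb poly_cheb_0 in auto)

section \<open>Factorization of \<open>phi\<close>\<close>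

lemma phi_conv_cosh:
  assumes "x \<ge> 0"
  shows "phi m x = 1 / cosh (real m * arsinh (sqrt x))"
proof -
  let ?\<theta> = "arsinh (sqrt x)"
  have plus: "exp ?\<theta> = G_plus x"
    using assms by (simp add: arsinh_real_def G_plus_def add_pos_nonneg add_nonneg_pos add.commute)
  \<comment> \<open>The product is the difference of squares (1 + x) - x.\<close>
  have "G_minus x * G_plus x = 1"
    using assms by (simp add: G_plus_def G_minus_def algebra_simps)
  then have minus: "exp (- ?\<theta>) = G_minus x"
    using inverse_unique[of "G_plus x" "G_minus x"] by (simp add: exp_minus plus mult.commute)
  show ?thesis
    using exp_of_nat_mult[of m ?\<theta>] exp_of_nat_mult[of m "- ?\<theta>"]
    by (simp add: phi_def cosh_field_def plus minus)
qed

lemma phi_even: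
  assumes "n \<ge> 1" "x \<ge> 0"
  shows "phi (2 * n) x = (\<Prod>k=1..n. 1 / (1 + b_coeff n k * x))"
  by (simp only: phi_conv_cosh[OF assms(2)] cosh_even_prod[OF assms(1)])
     (use assms in \<open>simp add: prod_dividef\<close>)

text \<open>The additional factor comes from cosh (arsinh (sqrt x)) = sqrt (1 + x); it will be the
  transform of N^2 / 2.\<close>

lemma phi_odd:
  assumes "x \<ge> 0"
  shows "phi (2 * n + 1) x = 1 / sqrt (1 + x) * (\<Prod>k=1..n. 1 / (1 + a_coeff n k * x))"
  by (simp only: phi_conv_cosh[OF assms(1)] cosh_odd_prod)
     (use assms in \<open>simp add: prod_dividef cosh_arsinh_real add.commute\<close>)

subsection \<open>Gamma laws\<close>

text \<open>Shape \<open>a\<close> and rate 1; scales enter later as images under multiplication.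
  The value at 0 is 0 for every shape.\<close>

definition gamma_density :: "real \<Rightarrow> real \<Rightarrow> real" where
  "gamma_density a x = (if x \<le> 0 then 0 else x powr (a - 1) * exp (- x) / Gamma a)"

abbreviation gamma_law :: "real \<Rightarrow> real measure" where
  "gamma_law a \<equiv> density lborel (\<lambda>x. ennreal (gamma_density a x))"

lemma gamma_density_nonneg [simp]: "a > 0 \<Longrightarrow> gamma_density a x \<ge> 0"
  by (auto simp: gamma_density_def Gamma_real_pos)

lemma borel_measurable_gamma_density [measurable]: "gamma_density a \<in> borel_measurable borel"
  unfolding gamma_density_def by measurable

lemma nn_integral_gamma_density:
  assumes "a > 0"
  shows "(\<integral>\<^sup>+x. ennreal (gamma_density a x) \<partial>lborel) = 1"
proof -
  have "(\<integral>\<^sup>+x. ennreal (gamma_density a x) \<partial>lborel) =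
      (\<integral>\<^sup>+t. ennreal (1 / Gamma a) * ennreal (indicator {0..} t * t powr (a - 1) / exp t) \<partial>lborel)"
    using assms
    by (intro nn_integral_cong_AE AE_I[where N = "{0}"])
       (auto simp: gamma_density_def indicator_def exp_minus field_simps Gamma_real_pos
             simp flip: ennreal_mult' split: if_splits)
  also have "\<dots> = ennreal (1 / Gamma a) * ennreal (Gamma a)"
    using assms by (subst nn_integral_cmult) (auto simp: Gamma_conv_nn_integral_real)
  also have "\<dots> = 1"
    using Gamma_real_pos[OF assms] less_imp_neq[OF Gamma_real_pos[OF assms]]
    by (subst ennreal_mult'[symmetric]) auto
  finally show ?thesis .
qed

lemma real_distribution_gamma_law: "a > 0 \<Longrightarrow> real_distribution (gamma_law a)"
  by (intro real_distribution.intro real_distribution_axioms.intro prob_spaceI)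
     (auto simp: emeasure_density nn_integral_gamma_density)

text \<open>The substitution y = t x turns the convolution into a Beta integral over t, and Beta a b
  = Gamma a Gamma b / Gamma (a + b) supplies the constant. The exponentials multiply to exp (- x),
  independent of t.\<close>

lemma convolution_gamma_density:
  assumes a: "a > 0" and b: "b > 0"
  shows "(\<integral>\<^sup>+y. ennreal (gamma_density a (x - y)) * ennreal (gamma_density b y) \<partial>lborel) =
           ennreal (gamma_density (a + b) x)"
proof (cases "x \<le> 0")
  case True
  \<comment> \<open>For x \<le> 0, the numbers x - y and y cannot both be positive.\<close>
  then have "gamma_density a (x - y) * gamma_density b y = 0" for y
    by (auto simp: gamma_density_def)
  then have *: "ennreal (gamma_density a (x - y)) * ennreal (gamma_density b y) = 0" for y
    using a b by (subst ennreal_mult[symmetric]) auto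
  have "(\<integral>\<^sup>+y. ennreal (gamma_density a (x - y)) * ennreal (gamma_density b y) \<partial>lborel) = 0"
    by (simp only: * nn_integral_const mult_zero_left)
  with True show ?thesis by (simp add: gamma_density_def)
next
  case False
  then have x: "x > 0" by simp
  have pos: "Gamma a > 0" "Gamma b > 0" "Gamma (a + b) > 0"
    using a b by (auto intro!: Gamma_real_pos)
  \<comment> \<open>The leading x is the Jacobian of y = t x; both arguments are positive exactly
    when 0 < t < 1.\<close>
  have scale: "x * (gamma_density a (x - t * x) * gamma_density b (t * x)) =
      gamma_density (a + b) x / Beta a b * (indicator {0<..<1} t * (t powr (b - 1) * (1 - t) powr (a - 1)))"
    for t
  proof (cases "t \<in> {0<..<1}")
    case True
    have *: "x - t * x = x * (1 - t)" by (simp add: algebra_simps)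
    have powr: "x powr (a + b - 1) = x * (x powr (a - 1) * x powr (b - 1))"
      using x by (simp add: powr_mult_base algebra_simps flip: powr_add)
    have exp: "exp (- (x * (1 - t))) * exp (- (t * x)) = exp (- x)"
      by (simp add: algebra_simps flip: exp_add)
    have "x * (gamma_density a (x - t * x) * gamma_density b (t * x)) =
        x * (x powr (a - 1) * x powr (b - 1)) * (exp (- (x * (1 - t))) * exp (- (t * x))) *
        (t powr (b - 1) * (1 - t) powr (a - 1)) / (Gamma a * Gamma b)"
      using True x by (simp add: * gamma_density_def powr_mult mult_le_0_iff)
    also have "\<dots> = gamma_density (a + b) x / Beta a b *
        (indicator {0<..<1} t * (t powr (b - 1) * (1 - t) powr (a - 1)))"
      unfolding exp powr[symmetric] using True x pos by (simp add: gamma_density_def Beta_def)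
    finally show ?thesis .
  next
    case False
    with x show ?thesis
      by (auto simp: gamma_density_def mult_le_0_iff)
  qed
  have "(\<integral>\<^sup>+y. ennreal (gamma_density a (x - y)) * ennreal (gamma_density b y) \<partial>lborel) =
      (\<integral>\<^sup>+t. ennreal (x * (gamma_density a (x - t * x) * gamma_density b (t * x))) \<partial>lborel)"
    using x a b
    by (subst nn_integral_real_affine[where c = x and t = 0])
       (auto simp: ennreal_mult mult.commute simp flip: nn_integral_cmult)
  also have "\<dots> = (\<integral>\<^sup>+t. ennreal (gamma_density (a + b) x / Beta a b) *
      (ennreal (t powr (b - 1) * (1 - t) powr (a - 1)) * indicator {0..1} t) \<partial>lborel)"
    unfolding scale
  proof (rule nn_integral_cong_AE)
    define C where "C = gamma_density (a + b) x / Beta a b"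
    have C: "C \<ge> 0"
      using a b pos by (simp add: C_def Beta_def)
    \<comment> \<open>The Beta integral is over the closed interval, the identity above over the
      open one; the endpoints form a null set.\<close>
    have "AE t in lborel. t \<noteq> 0 \<and> t \<noteq> (1 :: real)"
      using AE_lborel_singleton[of "0 :: real"] AE_lborel_singleton[of "1 :: real"] by eventually_elim simp
    then show "AE t in lborel. ennreal (gamma_density (a + b) x / Beta a b *
          (indicator {0<..<1} t * (t powr (b - 1) * (1 - t) powr (a - 1)))) =
        ennreal (gamma_density (a + b) x / Beta a b) *
          (ennreal (t powr (b - 1) * (1 - t) powr (a - 1)) * indicator {0..1} t)"
      unfolding C_def[symmetric] by eventually_elim (use C in \<open>auto simp: indicator_def ennreal_mult\<close>)
  qed
  also have "\<dots> = ennreal (gamma_density (a + b) x / Beta a b) *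
      (\<integral>\<^sup>+t. ennreal (t powr (b - 1) * (1 - t) powr (a - 1)) * indicator {0..1} t \<partial>lborel)"
    by (rule nn_integral_cmult) simp
  also have "(\<integral>\<^sup>+t. ennreal (t powr (b - 1) * (1 - t) powr (a - 1)) * indicator {0..1} t \<partial>lborel) =
      ennreal (Beta a b)"
    using nn_integral_has_integral_lebesgue[OF _ has_integral_Beta_real[OF b a]]
    by (simp add: Beta_commute mult.commute ennreal_mult' ennreal_indicator)
  also have "ennreal (gamma_density (a + b) x / Beta a b) * ennreal (Beta a b) =
      ennreal (gamma_density (a + b) x)"
    using a b pos less_imp_neq[OF pos(1)] less_imp_neq[OF pos(2)] less_imp_neq[OF pos(3)]
    by (subst ennreal_mult[symmetric]) (auto simp: Beta_def)
  finally show ?thesis .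
qed

text \<open>Induction from singletons, since an empty sum would have shape 0; each step convolves
  one variable with the independent sum of the others.\<close>

lemma (in prob_space) gamma_distributed_sum:
  assumes "finite I" "I \<noteq> {}" "\<And>i. i \<in> I \<Longrightarrow> a i > 0"
    and "\<And>i. i \<in> I \<Longrightarrow> distributed M lborel (X i) (gamma_density (a i))"
    and "indep_vars (\<lambda>i. borel) X I"
  shows "distributed M lborel (\<lambda>\<omega>. \<Sum>i\<in>I. X i \<omega>) (gamma_density (\<Sum>i\<in>I. a i))"
  using assms
proof (induction rule: finite_ne_induct)
  case (insert i I)
  have "distributed M lborel (\<lambda>\<omega>. X i \<omega> + (\<Sum>j\<in>I. X j \<omega>))
      (\<lambda>x. \<integral>\<^sup>+y. ennreal (gamma_density (a i) (x - y)) * ennreal (gamma_density (\<Sum>j\<in>I. a j) y) \<partial>lborel)"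
    using insert by (intro distributed_convolution indep_vars_sum) (auto intro!: indep_vars_subset)
  then show ?case
    using insert by (simp add: convolution_gamma_density sum_pos)
qed simp

text \<open>Multiplying the density by exp (- s y) gives (1 + s) powr (- a) times the density of a
  Gamma variable divided by 1 + s, and the latter integrates to 1.\<close>

lemma laplace_gamma_law:
  assumes a: "a > 0" and s: "s \<ge> 0"
  shows "(\<integral>y. exp (- (s * y)) \<partial>gamma_law a) = (1 + s) powr (- a)"
proof -
  have "exp (- (s * y)) * gamma_density a y =
      (1 + s) powr (- a) * ((1 + s) * gamma_density a (y * (1 + s)))" for y
  proof (cases "y \<le> 0")
    case True
    with s show ?thesis by (simp add: gamma_density_def mult_le_0_iff)
  next
    case False
    then have y: "y > 0" by simp
    have "(1 + s) powr (- a) * (1 + s) powr a = 1"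
      using s by (simp add: powr_minus)
    then have *: "(1 + s) powr (- a) * ((1 + s) * (1 + s) powr (a - 1)) = 1"
      using s by (simp add: powr_mult_base)
    have "(1 + s) powr (- a) * ((1 + s) * (y * (1 + s)) powr (a - 1)) =
        ((1 + s) powr (- a) * ((1 + s) * (1 + s) powr (a - 1))) * y powr (a - 1)"
      using s y by (simp add: powr_mult)
    then have powr: "(1 + s) powr (- a) * ((1 + s) * (y * (1 + s)) powr (a - 1)) = y powr (a - 1)"
      unfolding * by simp
    have "exp (- (s * y)) * gamma_density a y = y powr (a - 1) * exp (- (y * (1 + s))) / Gamma a"
      using y by (simp add: gamma_density_def algebra_simps flip: exp_add)
    also have "\<dots> = (1 + s) powr (- a) * ((1 + s) * gamma_density a (y * (1 + s)))"
      using s y by (simp add: gamma_density_def not_le mult_le_0_iff flip: powr)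
    finally show ?thesis .
  qed
  note * = this
  have "(\<integral>\<^sup>+y. ennreal (exp (- (s * y))) \<partial>gamma_law a) =
      (\<integral>\<^sup>+y. ennreal ((1 + s) powr (- a) * ((1 + s) * gamma_density a (y * (1 + s)))) \<partial>lborel)"
    using a by (subst nn_integral_density) (auto simp: mult.commute simp flip: * ennreal_mult)
  also have "\<dots> = ennreal ((1 + s) powr (- a)) * (\<integral>\<^sup>+y. ennreal (gamma_density a y) \<partial>lborel)"
    using a s
    by (subst (2) nn_integral_real_affine[where c = "1 + s" and t = 0])
       (auto simp: ennreal_mult mult.commute simp flip: nn_integral_cmult)
  finally have "(\<integral>\<^sup>+y. ennreal (exp (- (s * y))) \<partial>gamma_law a) = ennreal ((1 + s) powr (- a))"
    using a by (simp add: nn_integral_gamma_density)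
  then show ?thesis
    by (subst integral_eq_nn_integral) auto
qed

text \<open>Distribution functions are compared. For y \<ge> 0 the event is - r \<le> x \<le> r with
  r = sqrt (2 y); by symmetry it has twice the mass of the interval from 0 to r, where u = x^2 / 2
  is a valid substitution.\<close>

lemma distr_half_square_normal:
  "distr (density lborel std_normal_density) borel (\<lambda>x. x\<^sup>2 / 2) = gamma_law (1 / 2)"
proof (rule cdf_unique)
  let ?D = "distr (density lborel std_normal_density) borel (\<lambda>x. x\<^sup>2 / 2)"
  interpret N: prob_space "density lborel std_normal_density"
    by (rule prob_space_normal_density) simp
  show "real_distribution ?D"
    by (rule N.real_distribution_distr) simp
  show "real_distribution (gamma_law (1 / 2))"
    by (rule real_distribution_gamma_law) simp
  have "emeasure ?D {..y} = emeasure (gamma_law (1 / 2)) {..y}" for y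
  proof (cases "y \<ge> 0")
    case False
    then have "\<not> x\<^sup>2 / 2 \<le> y" for x :: real
      using zero_le_power2[of x] by linarith
    then have "(\<lambda>x. x\<^sup>2 / 2) -` {..y} = {}"
      by auto
    moreover have *: "ennreal (gamma_density (1 / 2) x) * indicator {..y} x = 0" for x
      using False by (auto simp: gamma_density_def indicator_def)
    have "emeasure (gamma_law (1 / 2)) {..y} = 0"
      by (subst emeasure_density, simp, simp, simp only: * nn_integral_const mult_zero_left)
    ultimately show ?thesis
      by (simp add: emeasure_distr emeasure_density)
  next
    case True
    define r where "r = sqrt (2 * y)"
    have r: "r \<ge> 0" "r\<^sup>2 / 2 = y" using True by (auto simp: r_def)
    have "x\<^sup>2 / 2 \<le> y \<longleftrightarrow> \<bar>x\<bar> \<le> \<bar>r\<bar>" for x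
      unfolding abs_le_square_iff by (rule iffI) (use r(2) in linarith)+
    then have vimage: "(\<lambda>x. x\<^sup>2 / 2) -` {..y} = {- r..r}"
      using r(1) by (simp add: set_eq_iff abs_le_iff) linarith
    have "emeasure ?D {..y} =
        (\<integral>\<^sup>+x. ennreal (std_normal_density x) * indicator {- r..r} x \<partial>lborel)"
      by (simp add: emeasure_distr emeasure_density vimage)
    \<comment> \<open>The point 0 is counted twice, which does not affect the integral.\<close>
    also have "\<dots> = (\<integral>\<^sup>+x. ennreal (std_normal_density x) * indicator {- r..0} x +
        ennreal (std_normal_density x) * indicator {0..r} x \<partial>lborel)"
      using r by (intro nn_integral_cong_AE AE_I[where N = "{0}"]) (auto simp: indicator_def split: if_splits)
    also have "\<dots> = (\<integral>\<^sup>+x. ennreal (std_normal_density x) * indicator {- r..0} x \<partial>lborel) +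
        (\<integral>\<^sup>+x. ennreal (std_normal_density x) * indicator {0..r} x \<partial>lborel)"
      by (rule nn_integral_add) auto
    also have "(\<integral>\<^sup>+x. ennreal (std_normal_density x) * indicator {- r..0} x \<partial>lborel) =
        (\<integral>\<^sup>+x. ennreal (std_normal_density x) * indicator {0..r} x \<partial>lborel)"
      by (subst nn_integral_real_affine[where c = "-1" and t = 0])
         (auto simp: normal_density_def indicator_def intro!: nn_integral_cong)
    also have "\<dots> + \<dots> = (\<integral>\<^sup>+x. ennreal (std_normal_density x) * indicator {0..r} x +
        ennreal (std_normal_density x) * indicator {0..r} x \<partial>lborel)"
      by (rule nn_integral_add[symmetric]) auto
    also have "\<dots> = (\<integral>\<^sup>+x. ennreal (gamma_density (1 / 2) (x\<^sup>2 / 2) * x * indicator {0..r} x) \<partial>lborel)"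
    proof (rule nn_integral_cong_AE)
      \<comment> \<open>The factor x is the derivative of x^2 / 2. It cancels the singularity of the
        density of shape 1/2, and Gamma (1/2) = sqrt pi matches the constants.\<close>
      have *: "gamma_density (1 / 2) (x\<^sup>2 / 2) * x = std_normal_density x + std_normal_density x" if "x > 0" for x
      proof -
        have powr: "(x\<^sup>2 / 2) powr (- (1 / 2)) = sqrt 2 / x"
          unfolding powr_minus using that by (simp add: powr_half_sqrt real_sqrt_divide)
        have "gamma_density (1 / 2) (x\<^sup>2 / 2) * x = sqrt 2 * exp (- (x\<^sup>2 / 2)) / sqrt pi"
          using that by (simp add: gamma_density_def Gamma_one_half_real powr)
        also have "\<dots> = std_normal_density x + std_normal_density x"
          by (simp add: normal_density_def real_sqrt_mult field_simps)
        finally show ?thesis .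
      qed
      show "AE x in lborel. ennreal (std_normal_density x) * indicator {0..r} x +
          ennreal (std_normal_density x) * indicator {0..r} x =
          ennreal (gamma_density (1 / 2) (x\<^sup>2 / 2) * x * indicator {0..r} x)"
        using AE_lborel_singleton[of "0 :: real"]
        by eventually_elim (auto simp: indicator_def * simp flip: ennreal_plus)
    qed
    also have "\<dots> = (\<integral>\<^sup>+x. ennreal (gamma_density (1 / 2) x * indicator {0\<^sup>2 / 2..r\<^sup>2 / 2} x) \<partial>lborel)"
      using r
      by (intro nn_integral_substitution[symmetric])
         (auto intro!: derivative_eq_intros continuous_intros simp: set_borel_measurable_def)
    also have "\<dots> = (\<integral>\<^sup>+x. ennreal (gamma_density (1 / 2) x) * indicator {..y} x \<partial>lborel)"
      using r True by (intro nn_integral_cong) (auto simp: indicator_def gamma_density_def)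
    finally show ?thesis
      by (simp add: emeasure_density)
  qed
  then show "cdf ?D = cdf (gamma_law (1 / 2))"
    by (simp add: cdf_def measure_def fun_eq_iff)
qed

text \<open>The two densities differ only at 0, where the exponential one is 1.\<close>

lemma density_exponential: "density lborel (exponential_density 1) = gamma_law 1"
  by (intro density_cong AE_I[where N = "{0}"])
     (auto simp: exponential_density_def gamma_density_def)

subsection \<open>Infinite divisibility through characteristic functions\<close>

text \<open>Independence means that the joint law is the product of the marginals. Here the joint
  law is the product measure itself, since restriction to \<open>I\<close> is the identity on its
  space.\<close>

lemma indep_vars_PiM_coordinates:
  assumes "I \<noteq> {}" and M: "\<And>i. i \<in> I \<Longrightarrow> prob_space (M i)"
  shows "prob_space.indep_vars (PiM I M) M (\<lambda>i \<omega>. \<omega> i) I"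
proof -
  interpret prob_space "PiM I M"
    by (rule prob_space_PiM) (rule M)
  have "distr (PiM I M) (PiM I M) (\<lambda>\<omega>. \<lambda>i\<in>I. \<omega> i) = PiM I M"
    using distr_cong[OF refl refl, of "PiM I M" "\<lambda>\<omega>. restrict \<omega> I" "\<lambda>\<omega>. \<omega>" "PiM I M"]
    by (simp add: space_PiM PiE_def extensional_restrict)
  also have "\<dots> = PiM I (\<lambda>i. distr (PiM I M) (M i) (\<lambda>\<omega>. \<omega> i))"
    by (intro PiM_cong) (simp_all add: distr_PiM_component M)
  finally show ?thesis
    using assms(1) by (subst indep_vars_iff_distr_eq_PiM') auto
qed

text \<open>Realizes prescribed laws on the line by independent coordinates. The target is
  \<open>borel\<close>, which has the same sets as each \<open>\<nu> i\<close>.\<close>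

lemma real_laws_PiM:
  fixes \<nu> :: "'i \<Rightarrow> real measure"
  assumes "I \<noteq> {}" and \<nu>: "\<And>i. i \<in> I \<Longrightarrow> real_distribution (\<nu> i)"
  shows prob_space_PiM_real: "prob_space (PiM I \<nu>)"
    and indep_vars_PiM_real: "prob_space.indep_vars (PiM I \<nu>) (\<lambda>_. borel) (\<lambda>i \<omega>. \<omega> i) I"
    and distr_PiM_real: "i \<in> I \<Longrightarrow> distr (PiM I \<nu>) borel (\<lambda>\<omega>. \<omega> i) = \<nu> i"
proof -
  have p: "prob_space (\<nu> i)" and s: "sets (\<nu> i) = sets borel" if "i \<in> I" for i
    using \<nu>[OF that] by (simp_all add: real_distribution_def real_distribution_axioms_def)
  show "prob_space (PiM I \<nu>)"
    by (rule prob_space_PiM) (rule p)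
  then interpret prob_space "PiM I \<nu>" .
  show "indep_vars (\<lambda>_. borel) (\<lambda>i \<omega>. \<omega> i) I"
    using indep_vars_compose2[OF indep_vars_PiM_coordinates[of I \<nu>], of "\<lambda>_ x. x" "\<lambda>_. borel"] assms(1) p s
    by (simp add: measurable_ident_sets)
  show "distr (PiM I \<nu>) borel (\<lambda>\<omega>. \<omega> i) = \<nu> i" if "i \<in> I"
    using distr_PiM_component[of I \<nu> i] distr_cong[of "PiM I \<nu>" "PiM I \<nu>" borel "\<nu> i"] p s that by simp
qed

lemma (in prob_space) real_distribution_distr_sum:
  assumes "indep_vars (\<lambda>_. borel) X I"
  shows "real_distribution (distr M borel (\<lambda>\<omega>. \<Sum>i\<in>I. X i \<omega>))"
  using assms by (intro real_distribution_distr borel_measurable_sum) (simp add: indep_vars_def)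

lemma (in prob_space) distr_sum_eqI_char:
  assumes "indep_vars (\<lambda>_. borel) X I" and "real_distribution \<nu>"
    and "\<And>t. char \<nu> t = (\<Prod>i\<in>I. char (distr M borel (X i)) t)"
  shows "distr M borel (\<lambda>\<omega>. \<Sum>i\<in>I. X i \<omega>) = \<nu>"
proof (rule Levy_uniqueness)
  show "real_distribution (distr M borel (\<lambda>\<omega>. \<Sum>i\<in>I. X i \<omega>))"
    by (rule real_distribution_distr_sum) fact
  show "char (distr M borel (\<lambda>\<omega>. \<Sum>i\<in>I. X i \<omega>)) = char \<nu>"
    by (simp add: fun_eq_iff char_distr_sum[OF assms(1)] assms(3))
qed fact

lemma same_law_sum:
  assumes "prob_space M" "prob_space.indep_vars M (\<lambda>_. borel) X I"
    and "prob_space M'" "prob_space.indep_vars M' (\<lambda>_. borel) Y I"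
    and eq: "\<And>i. i \<in> I \<Longrightarrow> distr M borel (X i) = distr M' borel (Y i)"
  shows "same_law M (\<lambda>\<omega>. \<Sum>i\<in>I. X i \<omega>) M' (\<lambda>\<omega>. \<Sum>i\<in>I. Y i \<omega>)"
proof -
  interpret M: prob_space M by fact
  interpret M': prob_space M' by fact
  show ?thesis
    unfolding same_law_def
    by (intro M.distr_sum_eqI_char assms(2) M'.real_distribution_distr_sum assms(4))
       (simp_all add: M'.char_distr_sum[OF assms(4)] eq)
qed

text \<open>Infinite divisibility as a property of the law alone: n-th roots of the characteristic
  function replace i.i.d. summands, so closure properties become identities between products and
  powers.\<close>

definition divisible_law :: "real measure \<Rightarrow> bool" where
  "divisible_law \<mu> \<longleftrightarrow>
     real_distribution \<mu> \<and>
     (\<forall>n\<ge>1. \<exists>\<nu>. real_distribution \<nu> \<and> (\<forall>t. char \<mu> t = char \<nu> t ^ n))"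

lemma char_distr_mult:
  "sets \<mu> = sets borel \<Longrightarrow> char (distr \<mu> borel (\<lambda>x. c * x)) t = char \<mu> (c * t)"
  unfolding char_def by (subst integral_distr) (auto simp: mult_ac cong: measurable_cong_sets)

lemma real_distribution_distr_borel:
  assumes "real_distribution \<mu>" "f \<in> borel_measurable borel"
  shows "real_distribution (distr \<mu> borel f)"
proof -
  interpret real_distribution \<mu> by fact
  show ?thesis using assms(2) by (intro real_distribution_distr) simp
qed

text \<open>Scaling replaces t by c t in every characteristic function, so the scaled n-th root is
  an n-th root of the scaled law.\<close>

lemma divisible_law_mult:
  assumes "divisible_law \<mu>"
  shows "divisible_law (distr \<mu> borel (\<lambda>x. c * x))"
  unfolding divisible_law_def
proof (intro conjI allI impI)
  have \<mu>: "real_distribution \<mu>" using assms by (simp add: divisible_law_def)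
  show "real_distribution (distr \<mu> borel (\<lambda>x. c * x))"
    by (intro real_distribution_distr_borel \<mu>) simp
  fix n :: nat assume "n \<ge> 1"
  then obtain \<nu> where \<nu>: "real_distribution \<nu>" "\<And>t. char \<mu> t = char \<nu> t ^ n"
    using assms by (auto simp: divisible_law_def)
  show "\<exists>\<nu>. real_distribution \<nu> \<and> (\<forall>t. char (distr \<mu> borel (\<lambda>x. c * x)) t = char \<nu> t ^ n)"
    using \<nu> \<mu>
    by (intro exI[of _ "distr \<nu> borel (\<lambda>x. c * x)"])
       (simp add: char_distr_mult real_distribution.events_eq_borel real_distribution_distr_borel)
qed

text \<open>Choose an n-th root of each summand's law; the law of the sum of independent variables
  with these laws is an n-th root, because powers distribute over the product of characteristic
  functions.\<close>

lemma (in prob_space) divisible_law_sum: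
  assumes indep: "indep_vars (\<lambda>_. borel) X I" and I: "I \<noteq> {}"
    and div: "\<And>i. i \<in> I \<Longrightarrow> divisible_law (distr M borel (X i))"
  shows "divisible_law (distr M borel (\<lambda>\<omega>. \<Sum>i\<in>I. X i \<omega>))"
  unfolding divisible_law_def
proof (intro conjI allI impI)
  show "real_distribution (distr M borel (\<lambda>\<omega>. \<Sum>i\<in>I. X i \<omega>))"
    by (rule real_distribution_distr_sum) fact
  fix n :: nat assume "n \<ge> 1"
  then have "\<forall>i\<in>I. \<exists>\<nu>. real_distribution \<nu> \<and> (\<forall>t. char (distr M borel (X i)) t = char \<nu> t ^ n)"
    using div by (auto simp: divisible_law_def)
  then obtain \<nu> where \<nu>: "\<And>i. i \<in> I \<Longrightarrow> real_distribution (\<nu> i)"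
      "\<And>i t. i \<in> I \<Longrightarrow> char (distr M borel (X i)) t = char (\<nu> i) t ^ n"
    by metis
  interpret P: prob_space "PiM I \<nu>"
    by (rule prob_space_PiM_real[of I \<nu>, OF I \<nu>(1)])
  note P_indep = indep_vars_PiM_real[of I \<nu>, OF I \<nu>(1)]
  show "\<exists>\<nu>. real_distribution \<nu> \<and> (\<forall>t. char (distr M borel (\<lambda>\<omega>. \<Sum>i\<in>I. X i \<omega>)) t = char \<nu> t ^ n)"
  proof (intro exI conjI allI)
    show "real_distribution (distr (PiM I \<nu>) borel (\<lambda>\<omega>. \<Sum>i\<in>I. \<omega> i))"
      by (rule P.real_distribution_distr_sum[OF P_indep])
    show "char (distr M borel (\<lambda>\<omega>. \<Sum>i\<in>I. X i \<omega>)) t = char (distr (PiM I \<nu>) borel (\<lambda>\<omega>. \<Sum>i\<in>I. \<omega> i)) t ^ n" for t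
      by (simp add: char_distr_sum[OF indep] P.char_distr_sum[OF P_indep] \<nu>(2) distr_PiM_real[of I \<nu>, OF I \<nu>(1)]
          prod_power_distrib)
  qed
qed

text \<open>The i.i.d. summands are the coordinates of the n-fold product of an n-th root
  \<open>\<nu>\<close>; their sum has the required characteristic function, hence the required
  law.\<close>

lemma infinitely_divisibleI:
  assumes "divisible_law (distr M borel \<zeta>)"
  shows "infinitely_divisible M \<zeta>"
  unfolding infinitely_divisible_def
proof (intro allI impI)
  fix n :: nat assume n: "n \<ge> 1"
  then obtain \<nu> where \<nu>: "real_distribution \<nu>" "\<And>t. char (distr M borel \<zeta>) t = char \<nu> t ^ n"
    using assms by (auto simp: divisible_law_def)
  let ?P = "PiM {1..n} (\<lambda>_. \<nu>)"
  have I: "{1..n} \<noteq> {}" using n by simp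
  interpret P: prob_space ?P
    by (rule prob_space_PiM_real[of "{1..n}" "\<lambda>_. \<nu>", OF I \<nu>(1)])
  note P_indep = indep_vars_PiM_real[of "{1..n}" "\<lambda>_. \<nu>", OF I \<nu>(1)]
  note law = distr_PiM_real[of "{1..n}" "\<lambda>_. \<nu>", OF I \<nu>(1)]
  have "distr ?P borel (\<lambda>\<omega>. \<Sum>i=1..n. \<omega> i) = distr M borel \<zeta>"
    by (intro P.distr_sum_eqI_char P_indep)
       (use assms in \<open>simp_all add: divisible_law_def \<nu>(2) law del: One_nat_def\<close>)
  then show "\<exists>(M' :: (nat \<Rightarrow> real) measure) Z.
        prob_space M' \<and> prob_space.indep_vars M' (\<lambda>_. borel) Z {1..n} \<and>
        (\<forall>i\<in>{1..n}. \<forall>j\<in>{1..n}. same_law M' (Z i) M' (Z j)) \<and>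
        same_law M \<zeta> M' (\<lambda>\<omega>. \<Sum>i=1..n. Z i \<omega>)"
    by (intro exI[of _ ?P] exI[of _ "\<lambda>i \<omega>. \<omega> i"]) (auto simp: same_law_def law P_indep P.prob_space_axioms simp del: One_nat_def)
qed

subsection \<open>Sums of independent scaled Gamma variables\<close>

text \<open>The n-th root is the Gamma law of shape a / n: the sum of n independent copies has shape
  a. Comparing characteristic functions of that sum gives the power identity without computing any
  of them.\<close>

lemma divisible_gamma_law:
  assumes "a > 0"
  shows "divisible_law (gamma_law a)"
  unfolding divisible_law_def
proof (intro conjI allI impI)
  show "real_distribution (gamma_law a)"
    by (rule real_distribution_gamma_law) fact
  fix n :: nat assume n: "n \<ge> 1"
  let ?\<nu> = "gamma_law (a / n)" and ?I = "{1..n}"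
  let ?P = "PiM ?I (\<lambda>_. ?\<nu>)"
  have I: "?I \<noteq> {}" and an: "a / n > 0" using n assms by auto
  note \<nu> = real_distribution_gamma_law[OF an]
  interpret P: prob_space ?P
    by (rule prob_space_PiM_real[OF I \<nu>])
  have indep: "P.indep_vars (\<lambda>_. borel) (\<lambda>i \<omega>. \<omega> i) ?I"
    by (rule indep_vars_PiM_real[OF I \<nu>])
  have law: "distr ?P borel (\<lambda>\<omega>. \<omega> i) = ?\<nu>" if "i \<in> ?I" for i
    by (rule distr_PiM_real[OF I \<nu> that])
  have "distributed ?P lborel (\<lambda>\<omega>. \<Sum>i\<in>?I. \<omega> i) (gamma_density (\<Sum>i\<in>?I. a / n))"
  proof (intro P.gamma_distributed_sum indep an I)
    show "distributed ?P lborel (\<lambda>\<omega>. \<omega> i) (gamma_density (a / n))" if "i \<in> ?I" for i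
      using law[OF that] indep that distr_cong[of ?P ?P lborel borel "\<lambda>\<omega>. \<omega> i"]
      by (simp add: distributed_def P.indep_vars_def del: One_nat_def)
  qed simp
  then have "distr ?P borel (\<lambda>\<omega>. \<Sum>i\<in>?I. \<omega> i) = gamma_law a"
    using n distr_cong[of ?P ?P lborel borel "\<lambda>\<omega>. \<Sum>i\<in>?I. \<omega> i"] by (simp add: distributed_def)
  then have "char (gamma_law a) t = char ?\<nu> t ^ n" for t
    using P.char_distr_sum[OF indep, of t] by (simp add: law del: One_nat_def)
  with \<nu> show "\<exists>\<nu>. real_distribution \<nu> \<and> (\<forall>t. char (gamma_law a) t = char \<nu> t ^ n)"
    by blast
qed

abbreviation scaled_gamma_law :: "real \<Rightarrow> real \<Rightarrow> real measure" where
  "scaled_gamma_law c a \<equiv> distr (gamma_law a) borel (\<lambda>x. c * x)"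

lemma AE_scaled_gamma_law_nonneg: "c \<ge> 0 \<Longrightarrow> AE x in scaled_gamma_law c a. x \<ge> 0"
  by (auto simp: AE_distr_iff AE_density gamma_density_def intro!: AE_I2)

lemma laplace_scaled_gamma_law:
  "a > 0 \<Longrightarrow> c \<ge> 0 \<Longrightarrow> s \<ge> 0 \<Longrightarrow>
     (\<integral>y. exp (- (s * y)) \<partial>scaled_gamma_law c a) = (1 + c * s) powr (- a)"
  using laplace_gamma_law[of a "c * s"] by (subst integral_distr) (simp_all add: mult_ac)

text \<open>The common setting of both parities: independent variables, each distributed as
  \<open>c i\<close> times a Gamma variable of shape \<open>a i\<close>.\<close>

locale gamma_family = prob_space +
  fixes X :: "'i \<Rightarrow> 'a \<Rightarrow> real" and I :: "'i set" and c a :: "'i \<Rightarrow> real"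
  assumes finite_index: "finite I" and nonempty_index: "I \<noteq> {}"
    and indep: "indep_vars (\<lambda>_. borel) X I"
    and shape_pos: "i \<in> I \<Longrightarrow> a i > 0" and scale_nonneg: "i \<in> I \<Longrightarrow> c i \<ge> 0"
    and law: "i \<in> I \<Longrightarrow> distr M borel (X i) = scaled_gamma_law (c i) (a i)"
begin

lemma measurable_term [measurable]: "i \<in> I \<Longrightarrow> X i \<in> borel_measurable M"
  using indep by (simp add: indep_vars_def)

lemma AE_term_nonneg:
  assumes "i \<in> I"
  shows "AE \<omega> in M. X i \<omega> \<ge> 0"
  using AE_scaled_gamma_law_nonneg[OF scale_nonneg[OF assms], of "a i"]
  unfolding law[OF assms, symmetric] by (rule AE_distrD[OF measurable_term[OF assms]])

lemma AE_sum_nonneg: "AE \<omega> in M. (\<Sum>i\<in>I. X i \<omega>) \<ge> 0"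
proof -
  have "AE \<omega> in M. \<forall>i\<in>I. X i \<omega> \<ge> 0"
    by (intro AE_finite_allI finite_index AE_term_nonneg)
  then show ?thesis by eventually_elim (simp add: sum_nonneg)
qed

text \<open>Independence factors the expectation; almost sure nonnegativity of the terms bounds each
  exponential by 1 and so gives integrability.\<close>

lemma laplace_transform_sum:
  assumes x: "x \<ge> 0"
  shows "laplace_transform M (\<lambda>\<omega>. \<Sum>i\<in>I. X i \<omega>) x = (\<Prod>i\<in>I. (1 + c i * x) powr (- a i))"
proof -
  have "laplace_transform M (\<lambda>\<omega>. \<Sum>i\<in>I. X i \<omega>) x = expectation (\<lambda>\<omega>. \<Prod>i\<in>I. exp (- (x * X i \<omega>)))"
    by (simp add: laplace_transform_def sum_distrib_left finite_index flip: sum_negf exp_sum)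
  also have "\<dots> = (\<Prod>i\<in>I. expectation (\<lambda>\<omega>. exp (- (x * X i \<omega>))))"
  proof (intro indep_vars_lebesgue_integral finite_index)
    show "indep_vars (\<lambda>_. borel) (\<lambda>i \<omega>. exp (- (x * X i \<omega>))) I"
      by (rule indep_vars_compose2[OF indep, of "\<lambda>_ y. exp (- (x * y))"]) simp
    show "integrable M (\<lambda>\<omega>. exp (- (x * X i \<omega>)))" if "i \<in> I" for i
    proof (rule integrable_const_bound[where B = 1])
      show "AE \<omega> in M. norm (exp (- (x * X i \<omega>))) \<le> 1"
        using AE_term_nonneg[OF that] by eventually_elim (use x in simp)
    qed (use that in simp)
  qed
  also have "\<dots> = (\<Prod>i\<in>I. (1 + c i * x) powr (- a i))"
  proof (rule prod.cong[OF refl])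
    fix i assume i: "i \<in> I"
    have "expectation (\<lambda>\<omega>. exp (- (x * X i \<omega>))) = (\<integral>y. exp (- (x * y)) \<partial>distr M borel (X i))"
      using i by (subst integral_distr) auto
    then show "expectation (\<lambda>\<omega>. exp (- (x * X i \<omega>))) = (1 + c i * x) powr (- a i)"
      using i x by (simp add: law laplace_scaled_gamma_law shape_pos scale_nonneg)
  qed
  finally show ?thesis .
qed

lemma divisible_law_distr_sum: "divisible_law (distr M borel (\<lambda>\<omega>. \<Sum>i\<in>I. X i \<omega>))"
  by (intro divisible_law_sum indep nonempty_index)
     (simp add: law divisible_law_mult divisible_gamma_law shape_pos)

end

text \<open>The law of the sum depends only on scales and shapes, so a representation built on one
  space is valid on every space carrying such variables.\<close>

lemma gamma_family_same_law:
  assumes "gamma_family M X I c a" "gamma_family M' Y I c a"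
  shows "same_law M (\<lambda>\<omega>. \<Sum>i\<in>I. X i \<omega>) M' (\<lambda>\<omega>. \<Sum>i\<in>I. Y i \<omega>)"
proof -
  interpret X: gamma_family M X I c a by fact
  interpret Y: gamma_family M' Y I c a by fact
  show ?thesis
    by (intro same_law_sum X.prob_space_axioms Y.prob_space_axioms X.indep Y.indep) (simp add: X.law Y.law)
qed

text \<open>Takes K to be the identity on the line under the law of the sum, and carries the
  properties of the sum over to it.\<close>

lemma gamma_family_law_representation:
  assumes "gamma_family P X I c a"
    and phi: "\<And>x. x \<ge> 0 \<Longrightarrow> phi m x = (\<Prod>i\<in>I. (1 + c i * x) powr (- a i))"
  defines "M \<equiv> distr P borel (\<lambda>\<omega>. \<Sum>i\<in>I. X i \<omega>)"
  shows "prob_space M \<and> (\<lambda>x. x) \<in> borel_measurable M \<and> (AE x in M. 0 \<le> x) \<and>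
    (\<forall>x\<ge>0. phi m x = laplace_transform M (\<lambda>x. x) x) \<and> infinitely_divisible M (\<lambda>x. x) \<and>
    distr M borel (\<lambda>x. x) = M"
proof -
  interpret gamma_family P X I c a by fact
  have M: "distr M borel (\<lambda>x. x) = M"
    by (rule distr_id2) (simp add: M_def)
  have "laplace_transform M (\<lambda>x. x) x = laplace_transform P (\<lambda>\<omega>. \<Sum>i\<in>I. X i \<omega>) x" for x
    by (simp add: laplace_transform_def M_def integral_distr)
  moreover have "AE x in M. 0 \<le> x"
    unfolding M_def using AE_sum_nonneg by (subst AE_distr_iff) simp_all
  moreover have "divisible_law (distr M borel (\<lambda>x. x))"
    unfolding M using divisible_law_distr_sum by (simp add: M_def)
  moreover have "prob_space M"
    unfolding M_def by (rule prob_space_distr) simp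
  moreover have "(\<lambda>x. x) \<in> borel_measurable M"
    by (simp add: M_def)
  ultimately show ?thesis
    by (simp add: phi laplace_transform_sum M infinitely_divisibleI)
qed

section \<open>The even and odd sums as Gamma families\<close>

lemma distributed_imp_distr_borel:
  "distributed M lborel X f \<Longrightarrow> distr M borel X = density lborel f"
  using distr_cong[of M M lborel borel X] by (simp add: distributed_def)

lemma distr_comp_borel:
  fixes X :: "'a \<Rightarrow> real" and f :: "real \<Rightarrow> real"
  assumes "X \<in> borel_measurable M" "f \<in> borel_measurable borel"
  shows "distr M borel (\<lambda>\<omega>. f (X \<omega>)) = distr (distr M borel X) borel f"
  using assms by (simp add: distr_distr comp_def)

lemma exponentials_gamma_family:
  assumes "exponentials n M e" "n \<ge> 1"
  shows "gamma_family M (\<lambda>k \<omega>. b_coeff n k * e k \<omega>) {1..n} (b_coeff n) (\<lambda>_. 1)"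
proof -
  interpret prob_space M using assms(1) by (simp add: exponentials_def)
  show ?thesis
  proof unfold_locales
    show "indep_vars (\<lambda>_. borel) (\<lambda>k \<omega>. b_coeff n k * e k \<omega>) {1..n}"
      using assms(1) indep_vars_compose2[of "\<lambda>_. borel" e "{1..n}" "\<lambda>k x. b_coeff n k * x" "\<lambda>_. borel"]
      by (simp add: exponentials_def)
    show "distr M borel (\<lambda>\<omega>. b_coeff n k * e k \<omega>) = scaled_gamma_law (b_coeff n k) 1" if "k \<in> {1..n}" for k
    proof -
      have d: "distributed M lborel (e k) (exponential_density 1)"
        using assms(1) that by (simp add: exponentials_def)
      then show ?thesis
        using distributed_measurable[OF d]
        by (subst distr_comp_borel) (simp_all add: distributed_imp_distr_borel density_exponential)
    qed
  qed (use assms(2) in \<open>auto simp: b_coeff_def\<close>)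
qed

lemma even_sum_eq: "even_sum n e = (\<lambda>\<omega>. \<Sum>k=1..n. b_coeff n k * e k \<omega>)"
  by (simp add: fun_eq_iff even_sum_def)

lemma even_sum_same_law:
  assumes "n \<ge> 1" "exponentials n M e" "exponentials n M' e'"
  shows "same_law M (even_sum n e) M' (even_sum n e')"
  unfolding even_sum_eq
  by (rule gamma_family_same_law[OF assms(2,3)[THEN exponentials_gamma_family, OF assms(1)]])

text \<open>Slot 0 holds the Gaussian contribution, so the odd case is one family over
  \<open>{0..n}\<close>; the scale 1 and shape 1/2 of that slot are those of N^2 / 2.\<close>

definition odd_term :: "nat \<Rightarrow> ('a \<Rightarrow> real) \<Rightarrow> (nat \<Rightarrow> 'a \<Rightarrow> real) \<Rightarrow> nat \<Rightarrow> 'a \<Rightarrow> real" where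
  "odd_term n N e k \<omega> = (if k = 0 then (N \<omega>)\<^sup>2 / 2 else a_coeff n k * e k \<omega>)"

definition odd_scale :: "nat \<Rightarrow> nat \<Rightarrow> real" where
  "odd_scale n k = (if k = 0 then 1 else a_coeff n k)"

definition odd_shape :: "nat \<Rightarrow> real" where
  "odd_shape k = (if k = 0 then 1 / 2 else 1)"

lemma atLeast0AtMost_eq_insert: "{0..n} = insert 0 {1..n :: nat}"
  by auto

lemma odd_sum_eq: "odd_sum n N e = (\<lambda>\<omega>. \<Sum>k=0..n. odd_term n N e k \<omega>)"
  by (auto simp: fun_eq_iff odd_sum_def odd_term_def atLeast0AtMost_eq_insert simp del: One_nat_def
      intro!: sum.cong)

lemma gaussian_and_exponentials_gamma_family:
  assumes "gaussian_and_exponentials n M N e"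
  shows "gamma_family M (odd_term n N e) {0..n} (odd_scale n) odd_shape"
proof -
  have exp: "exponentials n M e" and N: "distributed M lborel N std_normal_density"
    and ind: "prob_space.indep_vars M (\<lambda>_. borel) (e(0 := N)) {0..n}"
    using assms by (auto simp: gaussian_and_exponentials_def)
  interpret prob_space M using exp by (simp add: exponentials_def)
  show ?thesis
  proof unfold_locales
    show "indep_vars (\<lambda>_. borel) (odd_term n N e) {0..n}"
    proof (rule indep_vars_cong[THEN iffD1, OF refl _ refl])
      \<comment> \<open>Each term is a Borel function, chosen by slot, of the variable in that slot
        of \<open>e(0 := N)\<close>, so mutual independence is inherited.\<close>
      show "indep_vars (\<lambda>_. borel)
          (\<lambda>k \<omega>. (if k = 0 then \<lambda>x. x\<^sup>2 / 2 else (\<lambda>x. a_coeff n k * x)) ((e(0 := N)) k \<omega>)) {0..n}"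
        by (rule indep_vars_compose2[OF ind]) auto
    qed (auto simp: odd_term_def)
    show "distr M borel (odd_term n N e k) = scaled_gamma_law (odd_scale n k) (odd_shape k)"
      if "k \<in> {0..n}" for k
    proof (cases "k = 0")
      case True
      have "distr M borel (\<lambda>\<omega>. (N \<omega>)\<^sup>2 / 2) = gamma_law (1 / 2)"
        using distributed_measurable[OF N]
        by (subst distr_comp_borel[of N M "\<lambda>x. x\<^sup>2 / 2"])
           (simp_all add: distributed_imp_distr_borel[OF N] distr_half_square_normal)
      moreover have "odd_term n N e k = (\<lambda>\<omega>. (N \<omega>)\<^sup>2 / 2)"
        using True by (simp add: fun_eq_iff odd_term_def)
      ultimately show ?thesis
        using True by (simp add: odd_scale_def odd_shape_def distr_id2)
    next
      case False
      then have d: "distributed M lborel (e k) (exponential_density 1)"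
        using exp that by (simp add: exponentials_def)
      have "distr M borel (\<lambda>\<omega>. a_coeff n k * e k \<omega>) = scaled_gamma_law (a_coeff n k) 1"
        using distributed_measurable[OF d]
        by (subst distr_comp_borel) (simp_all add: distributed_imp_distr_borel[OF d] density_exponential)
      moreover have "odd_term n N e k = (\<lambda>\<omega>. a_coeff n k * e k \<omega>)"
        using False by (simp add: fun_eq_iff odd_term_def)
      ultimately show ?thesis
        using False by (simp add: odd_scale_def odd_shape_def)
    qed
  qed (auto simp: odd_scale_def odd_shape_def a_coeff_def)
qed

lemma odd_sum_same_law:
  assumes "gaussian_and_exponentials n M N e" "gaussian_and_exponentials n M' N' e'"
  shows "same_law M (odd_sum n N e) M' (odd_sum n N' e')"
  unfolding odd_sum_eq
  by (rule gamma_family_same_law[OF assms[THEN gaussian_and_exponentials_gamma_family]])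

section \<open>Existence of the Gaussian and exponential variables\<close>

lemma distributed_PiM_coordinate:
  assumes "I \<noteq> {}" "\<And>i. i \<in> I \<Longrightarrow> real_distribution (\<nu> i)" "i \<in> I"
    and "\<nu> i = density lborel f" "f \<in> borel_measurable borel"
  shows "distributed (PiM I \<nu>) lborel (\<lambda>\<omega>. \<omega> i) f"
proof -
  have "sets (\<nu> i) = sets borel"
    using assms(2)[OF assms(3)] by (simp add: real_distribution_def real_distribution_axioms_def)
  then have "(\<lambda>\<omega>. \<omega> i) \<in> borel_measurable (PiM I \<nu>)"
    using measurable_component_singleton[OF assms(3), of \<nu>] by (simp cong: measurable_cong_sets)
  then show ?thesis
    using distr_PiM_real[of I \<nu> i] distr_cong[of "PiM I \<nu>" "PiM I \<nu>" lborel borel "\<lambda>\<omega>. \<omega> i"] assms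
    by (simp add: distributed_def)
qed

lemma real_distribution_density_lborel:
  "prob_space (density lborel f) \<Longrightarrow> real_distribution (density lborel (f :: real \<Rightarrow> ennreal))"
  by (simp add: real_distribution_def real_distribution_axioms_def)

lemma ex_exponentials:
  assumes "n \<ge> 1"
  shows "\<exists>(M :: (nat \<Rightarrow> real) measure) e. exponentials n M e"
proof (intro exI)
  let ?\<nu> = "\<lambda>_ :: nat. density lborel (exponential_density 1)"
  have I: "{1..n} \<noteq> {}" using assms by simp
  have \<nu>: "real_distribution (?\<nu> i)" for i
    by (intro real_distribution_density_lborel prob_space_exponential_density) simp
  show "exponentials n (PiM {1..n} ?\<nu>) (\<lambda>k \<omega>. \<omega> k)"
    unfolding exponentials_def
  proof (intro conjI ballI)
    show "prob_space (PiM {1..n} ?\<nu>)"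
      by (rule prob_space_PiM_real[of _ ?\<nu>, OF I \<nu>])
    show "prob_space.indep_vars (PiM {1..n} ?\<nu>) (\<lambda>_. borel) (\<lambda>k \<omega>. \<omega> k) {1..n}"
      by (rule indep_vars_PiM_real[of _ ?\<nu>, OF I \<nu>])
    show "distributed (PiM {1..n} ?\<nu>) lborel (\<lambda>\<omega>. \<omega> k) (exponential_density 1)" if "k \<in> {1..n}" for k
      by (rule distributed_PiM_coordinate[of _ ?\<nu>, OF I \<nu> that]) simp_all
  qed
qed

lemma ex_gaussian_and_exponentials:
  "\<exists>(M :: (nat \<Rightarrow> real) measure) N e. gaussian_and_exponentials n M N e"
proof (intro exI)
  let ?\<nu> = "\<lambda>k :: nat. density lborel (if k = 0 then std_normal_density else exponential_density 1)"
  let ?P = "PiM {0..n} ?\<nu>"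
  have I: "{0..n} \<noteq> {}" by simp
  have \<nu>: "real_distribution (?\<nu> i)" for i
    by (intro real_distribution_density_lborel)
       (simp add: prob_space_exponential_density prob_space_normal_density)
  interpret prob_space ?P
    by (rule prob_space_PiM_real[of _ ?\<nu>, OF I \<nu>])
  have indep: "indep_vars (\<lambda>_. borel) (\<lambda>k \<omega>. \<omega> k) {0..n}"
    by (rule indep_vars_PiM_real[of _ ?\<nu>, OF I \<nu>])
  note d = distributed_PiM_coordinate[of _ ?\<nu>, OF I \<nu>]
  have "indep_vars (\<lambda>_. borel) (\<lambda>k \<omega>. \<omega> k) {1..n}"
    by (rule indep_vars_subset[OF indep]) auto
  moreover have "distributed ?P lborel (\<lambda>\<omega>. \<omega> k) (exponential_density 1)" if "k \<in> {1..n}" for k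
    using that by (intro d) auto
  moreover have "distributed ?P lborel (\<lambda>\<omega>. \<omega> 0) std_normal_density"
    by (intro d) auto
  \<comment> \<open>With N as coordinate 0, the family \<open>e(0 := N)\<close> is the full
    coordinate family, whose independence is known.\<close>
  moreover have "(\<lambda>k \<omega>. \<omega> k)(0 := \<lambda>\<omega>. \<omega> 0) = (\<lambda>k (\<omega> :: nat \<Rightarrow> real). \<omega> k)"
    by auto
  ultimately show "gaussian_and_exponentials n ?P (\<lambda>\<omega>. \<omega> 0) (\<lambda>k \<omega>. \<omega> k)"
    using indep prob_space_axioms by (simp add: gaussian_and_exponentials_def exponentials_def)
qed

section \<open>Matching the factorization with the Gamma families\<close>

lemma phi_odd_powr:
  assumes "x \<ge> 0"
  shows "phi (2 * n + 1) x = (\<Prod>k=0..n. (1 + odd_scale n k * x) powr (- odd_shape k))"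
proof -
  have "(1 + odd_scale n k * x) powr (- odd_shape k) = 1 / (1 + a_coeff n k * x)" if "k \<in> {1..n}" for k
  proof -
    have "a_coeff n k * x \<ge> 0" using assms by (simp add: a_coeff_def)
    then show ?thesis
      using that by (simp add: odd_scale_def odd_shape_def powr_minus_divide)
  qed
  then have "(\<Prod>k=1..n. (1 + odd_scale n k * x) powr (- odd_shape k)) = (\<Prod>k=1..n. 1 / (1 + a_coeff n k * x))"
    by (rule prod.cong[OF refl])
  then show ?thesis
    unfolding phi_odd[OF assms] atLeast0AtMost_eq_insert using assms
    by (simp add: odd_scale_def odd_shape_def powr_minus_divide powr_half_sqrt del: One_nat_def)
qed

lemma phi_even_powr:
  assumes "n \<ge> 1" "x \<ge> 0"
  shows "phi (2 * n) x = (\<Prod>k=1..n. (1 + b_coeff n k * x) powr (- 1))"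
  unfolding phi_even[OF assms]
proof (rule prod.cong[OF refl])
  fix k
  have "b_coeff n k * x \<ge> 0" using assms by (simp add: b_coeff_def)
  then show "1 / (1 + b_coeff n k * x) = (1 + b_coeff n k * x) powr (- 1)"
    by (simp add: powr_minus_divide)
qed

lemma same_law_identity:
  "same_law P S M' T \<Longrightarrow> same_law (distr P borel S) (\<lambda>x. x) M' T"
  by (simp add: same_law_def distr_id2)

text \<open>One law serves all spaces: the existential clauses show that the decompositions are
  realized, and the universal ones that any choice of such variables on \<open>'a\<close> gives the
  same law.\<close>

theorem proposition1p2:
  fixes m :: nat
  assumes "m \<ge> 1"
  shows "\<exists>(M :: real measure) (K :: real \<Rightarrow> real).
    prob_space M \<and> K \<in> borel_measurable M \<and> (AE \<omega> in M. 0 \<le> K \<omega>) \<and>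
    (\<forall>x\<ge>0. phi m x = laplace_transform M K x) \<and>
    infinitely_divisible M K \<and>
    (\<forall>n. m = 2 * n + 1 \<longrightarrow>
       (\<exists>(M' :: (nat \<Rightarrow> real) measure) N e.
          gaussian_and_exponentials n M' N e \<and> same_law M K M' (odd_sum n N e)) \<and>
       (\<forall>(M' :: 'a measure) N e.
          gaussian_and_exponentials n M' N e \<longrightarrow> same_law M K M' (odd_sum n N e))) \<and>
    (\<forall>n. m = 2 * n \<longrightarrow>
       (\<exists>(M' :: (nat \<Rightarrow> real) measure) e.
          exponentials n M' e \<and> same_law M K M' (even_sum n e)) \<and>
       (\<forall>(M' :: 'a measure) e.
          exponentials n M' e \<longrightarrow> same_law M K M' (even_sum n e)))"
proof (cases "even m")
  case True
  then obtain n where m: "m = 2 * n" by blast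
  with assms have n: "n \<ge> 1" by simp
  obtain P :: "(nat \<Rightarrow> real) measure" and e where e: "exponentials n P e"
    using ex_exponentials[OF n] by blast
  note rep = gamma_family_law_representation[OF exponentials_gamma_family[OF e n] phi_even_powr[OF n],
      folded m even_sum_eq]
  show ?thesis
  \<comment> \<open>The clauses quantify over every k with m = 2 k, and each time k = n. Those for
    odd m hold vacuously by parity.\<close>
  proof (intro exI[of _ "distr P borel (even_sum n e)"] exI[of _ "\<lambda>x. x"] conjI allI impI)
    fix k
    show "\<exists>(M' :: (nat \<Rightarrow> real) measure) e'. exponentials k M' e' \<and>
        same_law (distr P borel (even_sum n e)) (\<lambda>x. x) M' (even_sum k e')" if "m = 2 * k"
    proof -
      have "k = n" using that m by simp
      then show ?thesis using e even_sum_same_law[OF n e e, THEN same_law_identity] by blast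
    qed
    show "same_law (distr P borel (even_sum n e)) (\<lambda>x. x) M' (even_sum k e')"
      if "m = 2 * k" "exponentials k M' e'" for M' :: "'a measure" and e'
    proof -
      have "k = n" using that m by simp
      then show ?thesis using even_sum_same_law[OF n e, THEN same_law_identity] that(2) by blast
    qed
  qed (use rep True in \<open>auto simp only: even_mult_iff even_add odd_one even_numeral simp_thms\<close>)
next
  case False
  then obtain n where m: "m = 2 * n + 1" by (rule oddE)
  obtain P :: "(nat \<Rightarrow> real) measure" and N e where e: "gaussian_and_exponentials n P N e"
    using ex_gaussian_and_exponentials by blast
  note rep = gamma_family_law_representation[OF gaussian_and_exponentials_gamma_family[OF e]
      phi_odd_powr, folded m odd_sum_eq]
  show ?thesis
  proof (intro exI[of _ "distr P borel (odd_sum n N e)"] exI[of _ "\<lambda>x. x"] conjI allI impI)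
    fix k
    show "\<exists>(M' :: (nat \<Rightarrow> real) measure) N' e'. gaussian_and_exponentials k M' N' e' \<and>
        same_law (distr P borel (odd_sum n N e)) (\<lambda>x. x) M' (odd_sum k N' e')" if "m = 2 * k + 1"
    proof -
      have "k = n" using that m by simp
      then show ?thesis using e odd_sum_same_law[OF e e, THEN same_law_identity] by blast
    qed
    show "same_law (distr P borel (odd_sum n N e)) (\<lambda>x. x) M' (odd_sum k N' e')"
      if "m = 2 * k + 1" "gaussian_and_exponentials k M' N' e'" for M' :: "'a measure" and N' e'
    proof -
      have "k = n" using that m by simp
      then show ?thesis using odd_sum_same_law[OF e, THEN same_law_identity] that(2) by blast
    qed
  qed (use rep False in \<open>auto simp only: even_mult_iff even_add odd_one even_numeral simp_thms\<close>)
qed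

end
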